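(* For all real numbers $b,c\geq 0$, $$\int_0^{\pi/2}\mathbf K\left(\sqrt{\frac{4c\tan\theta}{b^{2}+(c+\tan\theta)^2}}\right)\frac{\sin\theta}{\sqrt{b^{2}+(c+\tan\theta)^2}}\,d\theta=\frac{\pi}{2\sqrt{(b+1)^{2}+c^2}}.$$
   Context: $\mathbf K(k)=\int_0^{\pi/2}\frac{d\varphi}{\sqrt{1-k^2\sin^2\varphi}}$ denotes the complete elliptic integral of the first kind with modulus $k$. *)

theory Defs
  imports "HOL-Analysis.Analysis"
begin

(* The argument is the modulus k, not the parameter m = k^2.  The integral is the usual one for
   0 <= k < 1.  At k = 1 it diverges, and ellipticK 1 is the junk value 0 that integral
   gives to non-integrable functions. *)
definition ellipticK :: "real \<Rightarrow> real" where
  "ellipticK k = integral {0..pi/2} (\<lambda>\<phi>. 1 / sqrt (1 - k\<^sup>2 * (sin \<phi>)\<^sup>2))"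

end

theory Submission
  imports Defs "HOL-Real_Asymp.Real_Asymp"
begin

text \<open>
  Put \<open>t = tan \<theta>\<close>. Since \<open>(c + t)\<^sup>2 - 4ct sin\<^sup>2 \<phi> = c\<^sup>2 + t\<^sup>2 + 2ct cos 2\<phi>\<close>, absorbing the factor
  \<open>1 / sqrt (b\<^sup>2 + (c + t)\<^sup>2)\<close> into the elliptic integral turns the left-hand side into
  an integral over a half-plane in the polar coordinates \<open>(t, 2\<phi>)\<close>, and by symmetry into a multiple of
  the integral over the whole plane, with integrand the product of
  \<open>(1 + t\<^sup>2) powr (-3/2)\<close> and the reciprocal distance from a point of the plane to a point at
  height \<open>b\<close> above the plane and at distance \<open>c\<close> from the axis. The first factor is,
  up to a constant, the Poisson kernel of the half-space at height 1, so the claim is the Poisson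
  formula for the harmonic function \<open>1/r\<close>.

  The Poisson formula is verified here by elementary means. With \<open>A = 1 + t\<^sup>2\<close> and with \<open>B\<close> the
  squared distance, a Feynman parameter \<open>q\<close> merges the two roots
  (\<open>nn_integral_Feynman_parameter\<close>):
  \<open>1 / (A sqrt A sqrt B) = (4/\<pi>) \<integral> q\<^sup>2 / (B + A q\<^sup>2)\<^sup>2 dq\<close> over \<open>q > 0\<close>.
  All integrands are nonnegative, so by Tonelli the integral over \<open>q\<close> may be taken last. The angular integral
  (\<open>nn_integral_angular\<close>) and the radial one (\<open>nn_integral_radial\<close>) of the reciprocal
  square of a quadratic polynomial are elementary. What remains is the integral of a rational
  function of \<open>q\<close>, which the substitution \<open>q - b/q\<close> evaluates (\<open>nn_integral_height\<close>).
\<close>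

section \<open>The fundamental theorem of calculus for nonnegative integrals\<close>

lemma nn_integral_FTC_einterval:
  fixes f F :: "real \<Rightarrow> real" and a b :: ereal
  assumes "a < b"
    and der: "\<And>x. a < ereal x \<Longrightarrow> ereal x < b \<Longrightarrow> (F has_real_derivative f x) (at x)"
    and cont: "\<And>x. a < ereal x \<Longrightarrow> ereal x < b \<Longrightarrow> isCont f x"
    and nonneg: "\<And>x. a < ereal x \<Longrightarrow> ereal x < b \<Longrightarrow> 0 \<le> f x"
    and A: "((F \<circ> real_of_ereal) \<longlongrightarrow> A) (at_right a)"
    and B: "((F \<circ> real_of_ereal) \<longlongrightarrow> B) (at_left b)"
  shows "(\<integral>\<^sup>+x\<in>einterval a b. ennreal (f x) \<partial>lborel) = ennreal (B - A)"
proof -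
  have ae: "AE x in lborel. a < ereal x \<longrightarrow> ereal x < b \<longrightarrow> 0 \<le> f x"
    using nonneg by auto
  have int: "set_integrable lborel (einterval a b) f"
    and val: "(LBINT x=a..b. f x) = B - A"
    using interval_integral_FTC_nonneg[OF \<open>a < b\<close> der cont ae A B] by auto
  have "(\<integral>\<^sup>+x\<in>einterval a b. ennreal (f x) \<partial>lborel)
      = (\<integral>\<^sup>+x. ennreal (indicator (einterval a b) x *\<^sub>R f x) \<partial>lborel)"
    by (intro nn_integral_cong) (auto simp: indicator_def)
  also have "\<dots> = ennreal (LBINT x:einterval a b. f x)"
    using int unfolding set_integrable_def set_lebesgue_integral_def
    by (intro nn_integral_eq_integral) (auto simp: indicator_def einterval_def nonneg)
  also have "(LBINT x:einterval a b. f x) = B - A"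
    using val \<open>a < b\<close> by (simp add: interval_lebesgue_integral_def less_imp_le)
  finally show ?thesis .
qed

lemma nn_integral_FTC_greaterThan_0:
  fixes f F :: "real \<Rightarrow> real"
  assumes "\<And>x. 0 < x \<Longrightarrow> (F has_real_derivative f x) (at x)"
    and "\<And>x. 0 < x \<Longrightarrow> isCont f x"
    and "\<And>x. 0 < x \<Longrightarrow> 0 \<le> f x"
    and "(F \<longlongrightarrow> A) (at_right 0)"
    and "(F \<longlongrightarrow> B) at_top"
  shows "(\<integral>\<^sup>+x\<in>{0<..}. ennreal (f x) \<partial>lborel) = ennreal (B - A)"
proof -
  have "einterval 0 \<infinity> = {0<..}"
    by (auto simp: einterval_def)
  moreover have "((F \<circ> real_of_ereal) \<longlongrightarrow> A) (at_right 0)"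
    unfolding zero_ereal_def ereal_tendsto_simps by (rule assms)
  ultimately show ?thesis
    using nn_integral_FTC_einterval[of 0 \<infinity> F f A B] assms
    by (simp add: ereal_tendsto_simps)
qed

text \<open>
  The substitution \<open>x = tan \<theta>\<close> is built into the primitive, so no change-of-variables theorem is
  needed, and the angles of the problem stay the variables of integration.
\<close>

lemma nn_integral_FTC_tan:
  fixes f F :: "real \<Rightarrow> real"
  assumes der: "\<And>x. 0 < x \<Longrightarrow> (F has_real_derivative f x) (at x)"
    and cont: "\<And>x. 0 < x \<Longrightarrow> isCont f x"
    and nonneg: "\<And>x. 0 < x \<Longrightarrow> 0 \<le> f x"
    and A: "(F \<longlongrightarrow> A) (at_right 0)"
    and B: "(F \<longlongrightarrow> B) at_top"
  shows "(\<integral>\<^sup>+\<theta>\<in>{0<..<pi/2}. ennreal (f (tan \<theta>) * (1 + (tan \<theta>)\<^sup>2)) \<partial>lborel) = ennreal (B - A)"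
proof -
  have eq: "einterval 0 (ereal (pi/2)) = {0<..<pi/2}"
    by (auto simp: einterval_def)
  have cos0: "cos x \<noteq> 0" if "0 < x" "x < pi/2" for x :: real
    using cos_gt_zero[OF that] by simp
  have "(\<integral>\<^sup>+\<theta>\<in>einterval 0 (ereal (pi/2)). ennreal (f (tan \<theta>) * (1 + (tan \<theta>)\<^sup>2)) \<partial>lborel)
      = ennreal (B - A)"
  proof (rule nn_integral_FTC_einterval[where F = "\<lambda>x. F (tan x)"])
    show "(0::ereal) < ereal (pi/2)" by simp
  next
    fix x :: real assume x: "0 < ereal x" "ereal x < ereal (pi/2)"
    then have x': "0 < x" "x < pi/2" by auto
    have t: "0 < tan x" using x' by (rule tan_gt_zero)
    have "(tan has_real_derivative inverse ((cos x)\<^sup>2)) (at x)"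
      by (rule DERIV_tan[OF cos0[OF x']])
    then have "(tan has_real_derivative (1 + (tan x)\<^sup>2)) (at x)"
      using tan_sec[OF cos0[OF x']] by (simp add: power_inverse)
    from DERIV_chain2[OF der[OF t] this]
    show "((\<lambda>x. F (tan x)) has_real_derivative f (tan x) * (1 + (tan x)\<^sup>2)) (at x)" .
    have "isCont (\<lambda>x. f (tan x)) x"
      by (rule isCont_o2[OF isCont_tan[OF cos0[OF x']] cont[OF t]])
    then show "isCont (\<lambda>\<theta>. f (tan \<theta>) * (1 + (tan \<theta>)\<^sup>2)) x"
      using cos0[OF x'] by (intro continuous_intros) auto
    show "0 \<le> f (tan x) * (1 + (tan x)\<^sup>2)"
      using nonneg[OF t] by simp
  next
    have "filterlim tan (at_right 0) (at_right (0::real))"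
      unfolding filterlim_at
    proof
      show "\<forall>\<^sub>F x::real in at_right 0. tan x \<in> {0<..} \<and> tan x \<noteq> 0"
        unfolding eventually_at_right_field
        by (rule exI[of _ "pi/2"]) (use tan_gt_zero in force)
      have "(tan \<longlongrightarrow> tan 0) (at (0::real) within {0<..})"
        by (rule tendsto_tan) (auto intro: tendsto_ident_at)
      then show "(tan \<longlongrightarrow> 0) (at_right (0::real))" by simp
    qed
    from filterlim_compose[OF A this]
    show "(((\<lambda>x. F (tan x)) \<circ> real_of_ereal) \<longlongrightarrow> A) (at_right 0)"
      unfolding zero_ereal_def ereal_tendsto_simps .
    from filterlim_compose[OF B filterlim_tan_at_left]
    show "(((\<lambda>x. F (tan x)) \<circ> real_of_ereal) \<longlongrightarrow> B) (at_left (ereal (pi/2)))"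
      unfolding ereal_tendsto_simps .
  qed
  then show ?thesis by (simp add: eq)
qed

section \<open>The one-dimensional integrals\<close>

lemma arctan_scaled_at_top:
  fixes r :: real assumes "r > 0"
  shows "((\<lambda>x. arctan (r * x)) \<longlongrightarrow> pi/2) at_top"
  by (rule filterlim_compose[OF tendsto_arctan_at_top])
     (use assms in \<open>auto intro: filterlim_tendsto_pos_mult_at_top[OF tendsto_const] filterlim_ident\<close>)

lemma tendsto_linear_over_quadratic:
  fixes M N :: real assumes "N > 0"
  shows "((\<lambda>x. x / (M + N * x\<^sup>2)) \<longlongrightarrow> 0) at_top"
  using assms by real_asymp

lemma DERIV_arctan_scaled:
  fixes M N x :: real assumes "M > 0" "N > 0"
  shows "((\<lambda>x. arctan (sqrt N / sqrt M * x)) has_real_derivative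
           M / (M + N * x\<^sup>2) * (sqrt N / sqrt M)) (at x)"
proof -
  have "1 + (sqrt N / sqrt M * x)\<^sup>2 = (M + N * x\<^sup>2) / M"
    using assms by (simp add: power_mult_distrib power_divide field_simps)
  then have "inverse (1 + (sqrt N / sqrt M * x)\<^sup>2) = M / (M + N * x\<^sup>2)" by simp
  then show ?thesis
    using DERIV_chain2[OF DERIV_arctan DERIV_cmult_Id[of "sqrt N / sqrt M" x]] by simp
qed

lemma DERIV_linear_over_quadratic:
  fixes M N x :: real assumes "M > 0" "N > 0"
  shows "((\<lambda>x. x / (M + N * x\<^sup>2)) has_real_derivative (M - N * x\<^sup>2) / (M + N * x\<^sup>2)\<^sup>2) (at x)"
proof -
  have "M + N * x\<^sup>2 > 0" using assms by (simp add: add_pos_nonneg)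
  then show ?thesis
    by (auto intro!: derivative_eq_intros simp: power2_eq_square algebra_simps)
qed

text \<open>
  Read from right to left, this replaces two roots of quadratic expressions, whose product would lead
  to elliptic integrals, by the square of one linear combination of \<^term>\<open>A\<close> and \<^term>\<open>B\<close>.
\<close>

lemma nn_integral_Feynman_parameter:
  fixes A B :: real assumes "A > 0" "B > 0"
  shows "(\<integral>\<^sup>+q\<in>{0<..}. ennreal (q\<^sup>2 / (B + A * q\<^sup>2)\<^sup>2) \<partial>lborel) = ennreal (pi / (4 * (A * sqrt A * sqrt B)))"
proof -
  define r where "r = sqrt A / sqrt B"
  have r: "r > 0" "r\<^sup>2 = A / B" using assms by (auto simp: r_def power_divide)
  have pos: "B + A * x\<^sup>2 > 0" for x using assms by (simp add: add_pos_nonneg)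
  define F where "F = (\<lambda>q. (arctan (r * q) / (r * B) - q / (B + A * q\<^sup>2)) / (2 * A))"
  have "(\<integral>\<^sup>+q\<in>{0<..}. ennreal (q\<^sup>2 / (B + A * q\<^sup>2)\<^sup>2) \<partial>lborel) = ennreal ((pi/2) / (r * B) / (2 * A) - 0)"
  proof (rule nn_integral_FTC_greaterThan_0[where F = F])
    fix x :: real assume "0 < x"
    have n: "B + A * x\<^sup>2 \<noteq> 0" using pos[of x] by simp
    have "(F has_real_derivative
        ((B / (B + A * x\<^sup>2) * r) / (r * B) - (B - A * x\<^sup>2) / (B + A * x\<^sup>2)\<^sup>2) / (2 * A)) (at x)"
      unfolding F_def r_def using assms
      by (intro DERIV_cdivide DERIV_diff DERIV_arctan_scaled DERIV_linear_over_quadratic) auto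
    also have "(B / (B + A * x\<^sup>2) * r) / (r * B) = (B + A * x\<^sup>2) / (B + A * x\<^sup>2)\<^sup>2"
      using r(1) assms n by (simp add: power2_eq_square)
    also have "((B + A * x\<^sup>2) / (B + A * x\<^sup>2)\<^sup>2 - (B - A * x\<^sup>2) / (B + A * x\<^sup>2)\<^sup>2) / (2 * A)
        = x\<^sup>2 / (B + A * x\<^sup>2)\<^sup>2"
      using assms by (simp add: diff_divide_distrib [symmetric])
    finally show "(F has_real_derivative x\<^sup>2 / (B + A * x\<^sup>2)\<^sup>2) (at x)" .
    show "isCont (\<lambda>q. q\<^sup>2 / (B + A * q\<^sup>2)\<^sup>2) x"
      using n by (intro continuous_intros) auto
    show "0 \<le> x\<^sup>2 / (B + A * x\<^sup>2)\<^sup>2" by simp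
  next
    have "isCont F 0" unfolding F_def using assms r(1) by (intro continuous_intros) auto
    then show "(F \<longlongrightarrow> 0) (at_right 0)"
      by (auto simp: isCont_def F_def intro: tendsto_mono at_le)
    have "(F \<longlongrightarrow> ((pi/2) / (r * B) - 0) / (2 * A)) at_top"
      unfolding F_def using assms r(1)
      by (intro tendsto_intros arctan_scaled_at_top tendsto_linear_over_quadratic) auto
    then show "(F \<longlongrightarrow> (pi/2) / (r * B) / (2 * A)) at_top" by simp
  qed
  also have "(pi/2) / (r * B) / (2 * A) - 0 = pi / (4 * (A * sqrt A * sqrt B))"
  proof -
    have "r * B = sqrt A * sqrt B" using assms by (simp add: r_def field_simps)
    then show ?thesis by (simp add: field_simps)
  qed
  finally show ?thesis .
qed

text \<open>
  In the variable \<open>u = tan \<phi>\<close> the integrand becomes \<open>(1 + u\<^sup>2) / (M + N u\<^sup>2)\<^sup>2\<close>, because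
  \<open>M - (M - N) sin\<^sup>2 \<phi> = M cos\<^sup>2 \<phi> + N sin\<^sup>2 \<phi>\<close>. Its primitive combines an arctangent with a
  multiple of \<open>u / (M + N u\<^sup>2)\<close>; the latter vanishes at both ends.
\<close>

lemma nn_integral_angular:
  fixes M N :: real assumes "M > 0" "N > 0"
  shows "(\<integral>\<^sup>+\<phi>\<in>{0<..<pi/2}. ennreal (1 / (M - (M - N) * (sin \<phi>)\<^sup>2)\<^sup>2) \<partial>lborel)
       = ennreal (pi * (M + N) / (4 * (M * N * sqrt (M * N))))"
proof -
  define r where "r = sqrt N / sqrt M"
  have r: "r > 0" "r\<^sup>2 = N / M" using assms by (auto simp: r_def power_divide)
  define a where "a = (1 / M - 1 / N) / 2"
  define d where "d = (1 / M + 1 / N) / 2 / (r * M)"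
  have pos: "M + N * x\<^sup>2 > 0" for x using assms by (simp add: add_pos_nonneg)
  define F where "F = (\<lambda>u. a * (u / (M + N * u\<^sup>2)) + d * arctan (r * u))"
  define f where "f = (\<lambda>u::real. (1 + u\<^sup>2) / (M + N * u\<^sup>2)\<^sup>2)"
  have "(\<integral>\<^sup>+\<phi>\<in>{0<..<pi/2}. ennreal (1 / (M - (M - N) * (sin \<phi>)\<^sup>2)\<^sup>2) \<partial>lborel)
     = (\<integral>\<^sup>+\<phi>\<in>{0<..<pi/2}. ennreal (f (tan \<phi>) * (1 + (tan \<phi>)\<^sup>2)) \<partial>lborel)"
  proof (intro nn_integral_cong, goal_cases)
    case (1 \<phi>)
    show ?case
    proof (cases "\<phi> \<in> {0<..<pi/2}")
      case True
      then have c: "cos \<phi> > 0" using cos_gt_zero by auto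
      have e1: "1 + (tan \<phi>)\<^sup>2 = 1 / (cos \<phi>)\<^sup>2"
        using tan_sec[of \<phi>] c by (simp add: field_simps)
      have s: "(sin \<phi>)\<^sup>2 = 1 - (cos \<phi>)\<^sup>2" by (simp add: sin_squared_eq)
      have "M - (M - N) * (sin \<phi>)\<^sup>2 = M * (cos \<phi>)\<^sup>2 + N * (sin \<phi>)\<^sup>2"
        by (simp add: s algebra_simps)
      also have "\<dots> = (M + N * (tan \<phi>)\<^sup>2) * (cos \<phi>)\<^sup>2"
        using c by (simp add: tan_def power_divide field_simps)
      finally have "1 / (M - (M - N) * (sin \<phi>)\<^sup>2)\<^sup>2
          = 1 / ((M + N * (tan \<phi>)\<^sup>2)\<^sup>2 * ((cos \<phi>)\<^sup>2)\<^sup>2)"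
        by (simp add: power_mult_distrib)
      also have "\<dots> = f (tan \<phi>) * (1 + (tan \<phi>)\<^sup>2)"
        unfolding f_def e1 by (simp add: power2_eq_square)
      finally show ?thesis by simp
    qed simp
  qed
  also have "\<dots> = ennreal (d * (pi/2) - 0)"
  proof (rule nn_integral_FTC_tan[where F = F])
    fix x :: real assume "0 < x"
    have n: "M + N * x\<^sup>2 \<noteq> 0" using pos[of x] by simp
    have "(F has_real_derivative
        a * ((M - N * x\<^sup>2) / (M + N * x\<^sup>2)\<^sup>2) + d * (M / (M + N * x\<^sup>2) * r)) (at x)"
      unfolding F_def r_def using assms
      by (intro DERIV_add DERIV_cmult DERIV_arctan_scaled DERIV_linear_over_quadratic) auto
    also have "d * (M / (M + N * x\<^sup>2) * r) = (1 / M + 1 / N) / 2 * ((M + N * x\<^sup>2) / (M + N * x\<^sup>2)\<^sup>2)"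
      using r(1) assms n by (simp add: power2_eq_square d_def)
    also have "a * ((M - N * x\<^sup>2) / (M + N * x\<^sup>2)\<^sup>2)
        + (1 / M + 1 / N) / 2 * ((M + N * x\<^sup>2) / (M + N * x\<^sup>2)\<^sup>2)
        = (a * (M - N * x\<^sup>2) + (1 / M + 1 / N) / 2 * (M + N * x\<^sup>2)) / (M + N * x\<^sup>2)\<^sup>2"
      unfolding times_divide_eq_right by (rule add_divide_distrib [symmetric])
    also have "a * (M - N * x\<^sup>2) + (1 / M + 1 / N) / 2 * (M + N * x\<^sup>2) = 1 + x\<^sup>2"
      using assms by (simp add: a_def field_simps)
    also have "(1 + x\<^sup>2) / (M + N * x\<^sup>2)\<^sup>2 = f x" by (simp add: f_def)
    finally show "(F has_real_derivative f x) (at x)" .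
    show "isCont f x" unfolding f_def
      using n by (intro continuous_intros) auto
    show "0 \<le> f x" by (simp add: f_def)
  next
    have "isCont F 0" unfolding F_def using assms by (intro continuous_intros) auto
    then show "(F \<longlongrightarrow> 0) (at_right 0)"
      by (auto simp: isCont_def F_def intro: tendsto_mono at_le)
    have "(F \<longlongrightarrow> a * 0 + d * (pi/2)) at_top"
      unfolding F_def using assms r(1)
      by (intro tendsto_intros arctan_scaled_at_top tendsto_linear_over_quadratic) auto
    then show "(F \<longlongrightarrow> d * (pi/2)) at_top" by simp
  qed
  also have "d * (pi/2) - 0 = pi * (M + N) / (4 * (M * N * sqrt (M * N)))"
  proof -
    have "r * M = sqrt (M * N)" using assms by (simp add: r_def real_sqrt_mult field_simps)
    then show ?thesis using assms by (simp add: d_def field_simps)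
  qed
  finally show ?thesis .
qed

text \<open>
  With \<open>t = tan \<theta>\<close> the integrand has the primitive \<open>(P t\<^sup>2 - Q) / (2 (P Q - c\<^sup>2) sqrt (R t))\<close>, which
  tends to opposite values at 0 and at infinity. It is found by looking for a primitive
  of the form \<open>(l w + m) / sqrt R\<close> in \<open>w = t\<^sup>2\<close>.
\<close>

lemma nn_integral_radial:
  fixes P Q c :: real assumes "P > 0" "Q > 0" "c\<^sup>2 < P * Q"
  defines "R \<equiv> \<lambda>t. (P * t\<^sup>2 + Q)\<^sup>2 - (2 * c * t)\<^sup>2"
  shows "(\<integral>\<^sup>+\<theta>\<in>{0<..<pi/2}. ennreal (2 * tan \<theta> * (P * (tan \<theta>)\<^sup>2 + Q) / (R (tan \<theta>) * sqrt (R (tan \<theta>)))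
             * (1 + (tan \<theta>)\<^sup>2)) \<partial>lborel)
       = ennreal (1 / (P * Q - c\<^sup>2))"
proof -
  define K where "K = P * Q - c\<^sup>2"
  have K: "K > 0" using assms by (simp add: K_def)
  have Rpos: "R t > 0" for t
  proof -
    have "R t = (P * t\<^sup>2 - Q)\<^sup>2 + 4 * K * t\<^sup>2"
      by (simp add: R_def K_def power2_eq_square algebra_simps)
    moreover have "(P * t\<^sup>2 - Q)\<^sup>2 + 4 * K * t\<^sup>2 > 0"
    proof (cases "t = 0")
      case True then show ?thesis using assms by simp
    next
      case False then show ?thesis using K by (simp add: add_nonneg_pos)
    qed
    ultimately show ?thesis by simp
  qed
  define F where "F = (\<lambda>t. (P * t\<^sup>2 - Q) / (2 * K * sqrt (R t)))"
  define f where "f = (\<lambda>t. 2 * t * (P * t\<^sup>2 + Q) / (R t * sqrt (R t)))"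
  have "(\<integral>\<^sup>+\<theta>\<in>{0<..<pi/2}. ennreal (f (tan \<theta>) * (1 + (tan \<theta>)\<^sup>2)) \<partial>lborel)
      = ennreal (1 / (2 * K) - (- 1 / (2 * K)))"
  proof (rule nn_integral_FTC_tan[where F = F])
    fix x :: real assume "0 < x"
    define s where "s = sqrt (R x)"
    have s: "s > 0" "s * s = R x" using Rpos[of x] by (auto simp: s_def)
    define R' where "R' = 2 * (P * x\<^sup>2 + Q) * (2 * P * x) - 2 * (2 * c * x) * (2 * c)"
    have dR: "(R has_real_derivative R') (at x)"
      unfolding R_def R'_def by (auto intro!: derivative_eq_intros)
    have dS: "((\<lambda>t. sqrt (R t)) has_real_derivative R' / (2 * s)) (at x)"
      using DERIV_chain2[OF DERIV_real_sqrt[OF Rpos[of x]] dR] by (simp add: s_def field_simps)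
    have "(F has_real_derivative
        ((2 * P * x) * (2 * K * s) - (P * x\<^sup>2 - Q) * (2 * K * (R' / (2 * s)))) / ((2 * K * s) * (2 * K * s))) (at x)"
      unfolding F_def s_def
    proof (intro DERIV_divide DERIV_cmult dS[unfolded s_def])
      show "((\<lambda>t. P * t\<^sup>2 - Q) has_real_derivative 2 * P * x) (at x)"
        by (auto intro!: derivative_eq_intros)
      show "2 * K * sqrt (R x) \<noteq> 0" using K s(1) by (simp add: s_def)
    qed
    also have "((2 * P * x) * (2 * K * s) - (P * x\<^sup>2 - Q) * (2 * K * (R' / (2 * s)))) / ((2 * K * s) * (2 * K * s))
      = (4 * P * x * (s * s) - (P * x\<^sup>2 - Q) * R') / (4 * K * (s * s) * s)"
      using s(1) K by (simp add: field_simps)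
    also have "4 * P * x * (s * s) - (P * x\<^sup>2 - Q) * R' = 8 * K * x * (P * x\<^sup>2 + Q)"
      unfolding s R_def R'_def K_def by (simp add: power2_eq_square algebra_simps)
    also have "8 * K * x * (P * x\<^sup>2 + Q) / (4 * K * (s * s) * s) = f x"
      unfolding f_def s_def[symmetric] s(2)[symmetric] using K s(1) by (simp add: field_simps)
    finally show "(F has_real_derivative f x) (at x)" .
    have "R x \<noteq> 0" using Rpos[of x] by simp
    moreover have "isCont R x" using dR by (rule DERIV_isCont)
    ultimately show "isCont f x" unfolding f_def
      by (intro continuous_intros) auto
    show "0 \<le> f x" using \<open>0 < x\<close> assms Rpos[of x] by (simp add: f_def)
  next
    have "isCont F 0" unfolding F_def using K Rpos[of 0] unfolding R_def by (intro continuous_intros) auto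
    moreover have "F 0 = - 1 / (2 * K)" using assms(2) by (simp add: F_def R_def)
    ultimately show "(F \<longlongrightarrow> - 1 / (2 * K)) (at_right 0)"
      by (auto simp: isCont_def intro: tendsto_mono at_le)
    \<comment> \<open>In the variable \<open>v = 1/t\<close> the primitive extends continuously to \<open>v = 0\<close>.\<close>
    define G where "G = (\<lambda>v. (P - Q * v\<^sup>2) / (2 * K * sqrt ((P + Q * v\<^sup>2)\<^sup>2 - (2 * c * v)\<^sup>2)))"
    have "isCont G 0" unfolding G_def using assms(1) K by (intro continuous_intros) auto
    from isCont_tendsto_compose[OF this tendsto_inverse_0_at_top[OF filterlim_ident]]
    have "((\<lambda>t. G (inverse t)) \<longlongrightarrow> 1 / (2 * K)) at_top"
      using assms(1) by (simp add: G_def)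
    moreover have "\<forall>\<^sub>F t in at_top. G (inverse t) = F t"
      using eventually_gt_at_top[of 0]
    proof eventually_elim
      case (elim t)
      have "R t = ((P + Q * (inverse t)\<^sup>2)\<^sup>2 - (2 * c * inverse t)\<^sup>2) * (t\<^sup>2)\<^sup>2"
        using elim by (simp add: R_def power2_eq_square field_simps)
      then have "sqrt (R t) = sqrt ((P + Q * (inverse t)\<^sup>2)\<^sup>2 - (2 * c * inverse t)\<^sup>2) * t\<^sup>2"
        by (simp only: real_sqrt_mult real_sqrt_abs abs_power2)
      moreover have "P * t\<^sup>2 - Q = (P - Q * (inverse t)\<^sup>2) * t\<^sup>2"
        using elim by (simp add: power2_eq_square field_simps)
      ultimately show ?case
        using elim by (simp add: G_def F_def)
    qed
    ultimately show "(F \<longlongrightarrow> 1 / (2 * K)) at_top"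
      by (rule Lim_transform_eventually)
  qed
  also have "1 / (2 * K) - (- 1 / (2 * K)) = 1 / (P * Q - c\<^sup>2)"
    using K by (simp add: K_def[symmetric])
  finally show ?thesis unfolding f_def .
qed

lemma DERIV_arctan_primitive:
  fixes S x :: real assumes "S > 0"
  shows "((\<lambda>x. arctan (1 / S * x) / S) has_real_derivative 1 / (x\<^sup>2 + S\<^sup>2)) (at x)"
proof -
  have "((\<lambda>x. arctan (1 / S * x) / S) has_real_derivative S\<^sup>2 / (S\<^sup>2 + x\<^sup>2) * (1 / S) / S) (at x)"
    using DERIV_cdivide[OF DERIV_arctan_scaled[of "S\<^sup>2" 1 x], of S] assms by simp
  also have "S\<^sup>2 / (S\<^sup>2 + x\<^sup>2) * (1 / S) / S = 1 / (x\<^sup>2 + S\<^sup>2)"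
    using assms by (simp add: power2_eq_square add.commute)
  finally show ?thesis .
qed

text \<open>
  For \<^term>\<open>T = 0\<close> the usual primitive, an arctangent divided by \<^term>\<open>T\<close>, has to be replaced by
  \<^term>\<open>- 1 / x\<close>. Only the existence of a limit at infinity matters later, because it cancels.
\<close>

lemma ex_antiderivative_inverse_sum_squares:
  fixes T :: real assumes "T \<ge> 0"
  obtains G L where "\<And>x. x > 0 \<Longrightarrow> (G has_real_derivative 1 / (x\<^sup>2 + T\<^sup>2)) (at x)"
    and "(G \<longlongrightarrow> L) at_top"
proof (cases "T = 0")
  case True
  show ?thesis
  proof (rule that)
    show "((\<lambda>x. - inverse x) has_real_derivative 1 / (x\<^sup>2 + T\<^sup>2)) (at x)" if "x > 0" for x :: real
      using that True by (auto intro!: derivative_eq_intros simp: power2_eq_square divide_simps)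
    show "((\<lambda>x::real. - inverse x) \<longlongrightarrow> 0) at_top"
      by real_asymp
  qed
next
  case False
  with assms have T: "T > 0" by simp
  show ?thesis
  proof (rule that)
    show "((\<lambda>x. arctan (1 / T * x) / T) has_real_derivative 1 / (x\<^sup>2 + T\<^sup>2)) (at x)" for x
      by (rule DERIV_arctan_primitive[OF T])
  next
    show "((\<lambda>x. arctan (1 / T * x) / T) \<longlongrightarrow> (pi/2) / T) at_top"
      using T by (intro tendsto_intros arctan_scaled_at_top) auto
  qed
qed

text \<open>
  The denominator is \<open>q\<^sup>2 W\<close> with \<open>W = q\<^sup>2 + b\<^sup>2/q\<^sup>2 + 1 + b\<^sup>2 + c\<^sup>2\<close>, and \<open>W\<close> is both
  \<open>(q - b/q)\<^sup>2 + (b + 1)\<^sup>2 + c\<^sup>2\<close> and \<open>(q + b/q)\<^sup>2 + (b - 1)\<^sup>2 + c\<^sup>2\<close>. Since \<open>q - b/q\<close> and \<open>q + b/q\<close>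
  have derivatives with sum 2, half the sum of the two corresponding primitives is a primitive of \<open>1/W\<close>.
  For \<^term>\<open>b > 0\<close> the second one contributes nothing, as \<open>q + b/q\<close> tends to infinity at both ends,
  while \<open>q - b/q\<close> runs over the whole real line.
\<close>

lemma nn_integral_height:
  fixes b c :: real assumes "b \<ge> 0"
  shows "(\<integral>\<^sup>+q\<in>{0<..}. ennreal (q\<^sup>2 / ((1 + q\<^sup>2) * (b\<^sup>2 + c\<^sup>2 + q\<^sup>2) - c\<^sup>2)) \<partial>lborel)
       = ennreal (pi / (2 * sqrt ((b + 1)\<^sup>2 + c\<^sup>2)))"
proof -
  define S where "S = sqrt ((b + 1)\<^sup>2 + c\<^sup>2)"
  have S: "S > 0" "S\<^sup>2 = (b + 1)\<^sup>2 + c\<^sup>2"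
    using assms by (auto simp: S_def add_pos_nonneg)
  define f where "f = (\<lambda>q::real. q\<^sup>2 / ((1 + q\<^sup>2) * (b\<^sup>2 + c\<^sup>2 + q\<^sup>2) - c\<^sup>2))"
  define H where "H = (\<lambda>x. arctan (1 / S * x) / S)"
  have dH: "(H has_real_derivative 1 / (x\<^sup>2 + S\<^sup>2)) (at x)" for x
    unfolding H_def by (rule DERIV_arctan_primitive[OF S(1)])
  have Htop: "(H \<longlongrightarrow> (pi/2) / S) at_top"
    unfolding H_def using S(1) by (intro tendsto_intros arctan_scaled_at_top) auto
  have Hbot: "(H \<longlongrightarrow> - ((pi/2) / S)) at_bot"
  proof -
    have "((\<lambda>x. - H (- x)) \<longlongrightarrow> - ((pi/2) / S)) at_bot"
      by (intro tendsto_minus filterlim_compose[OF Htop] filterlim_uminus_at_top_at_bot)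
    moreover have "(\<lambda>x. - H (- x)) = H" by (simp add: H_def fun_eq_iff arctan_minus)
    ultimately show ?thesis by simp
  qed
  have denom: "(1 + q\<^sup>2) * (b\<^sup>2 + c\<^sup>2 + q\<^sup>2) - c\<^sup>2 = (1 + q\<^sup>2) * (b\<^sup>2 + q\<^sup>2) + c\<^sup>2 * q\<^sup>2" for q
    by (simp add: algebra_simps)
  have pos: "(1 + q\<^sup>2) * (b\<^sup>2 + c\<^sup>2 + q\<^sup>2) - c\<^sup>2 > 0" if "q > 0" for q
    unfolding denom using that by (intro add_pos_nonneg mult_pos_pos add_nonneg_pos) auto
  have nonneg: "f q \<ge> 0" if "q > 0" for q
    using pos[OF that] by (simp add: f_def)
  have cont: "isCont f q" if "q > 0" for q
    unfolding f_def using pos[OF that] by (intro continuous_intros) auto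
  have "(\<integral>\<^sup>+q\<in>{0<..}. ennreal (f q) \<partial>lborel) = ennreal (pi / (2 * S))"
  proof (cases "b = 0")
    case True
    have "(\<integral>\<^sup>+q\<in>{0<..}. ennreal (f q) \<partial>lborel) = ennreal ((pi/2) / S - 0)"
    proof (rule nn_integral_FTC_greaterThan_0[where F = H])
      fix x :: real assume x: "0 < x"
      have "(1 + x\<^sup>2) * (b\<^sup>2 + c\<^sup>2 + x\<^sup>2) - c\<^sup>2 = x\<^sup>2 * (x\<^sup>2 + S\<^sup>2)"
        unfolding S(2) using True by (simp add: algebra_simps)
      then have "f x = 1 / (x\<^sup>2 + S\<^sup>2)" using x by (simp add: f_def)
      then show "(H has_real_derivative f x) (at x)" using dH by simp
    next
      have "isCont H 0" using dH by (rule DERIV_isCont)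
      then show "(H \<longlongrightarrow> 0) (at_right 0)"
        by (auto simp: isCont_def H_def intro: tendsto_mono at_le)
    qed (use cont nonneg Htop in auto)
    then show ?thesis by simp
  next
    case False
    with assms have b: "b > 0" by simp
    define T where "T = sqrt ((b - 1)\<^sup>2 + c\<^sup>2)"
    have T: "T \<ge> 0" "T\<^sup>2 = (b - 1)\<^sup>2 + c\<^sup>2" by (auto simp: T_def)
    obtain G L where G: "\<And>x. x > 0 \<Longrightarrow> (G has_real_derivative 1 / (x\<^sup>2 + T\<^sup>2)) (at x)"
      and GL: "(G \<longlongrightarrow> L) at_top"
      using ex_antiderivative_inverse_sum_squares[OF T(1)] by blast
    define F where "F = (\<lambda>q. (H (q - b / q) + G (q + b / q)) / 2)"
    have "(\<integral>\<^sup>+q\<in>{0<..}. ennreal (f q) \<partial>lborel) = ennreal (((pi/2) / S + L) / 2 - (- ((pi/2) / S) + L) / 2)"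
    proof (rule nn_integral_FTC_greaterThan_0[where F = F])
      fix x :: real assume x: "0 < x"
      define W where "W = x\<^sup>2 + (b / x)\<^sup>2 + 1 + b\<^sup>2 + c\<^sup>2"
      have W: "(x - b / x)\<^sup>2 + S\<^sup>2 = W" "(x + b / x)\<^sup>2 + T\<^sup>2 = W"
        unfolding W_def S(2) T(2) using x by (simp_all add: power2_eq_square field_simps)
      have Wpos: "W > 0"
        unfolding W_def by (intro add_pos_nonneg add_nonneg_pos) auto
      have d1: "((\<lambda>q. q - b / q) has_real_derivative 1 + b / x\<^sup>2) (at x)"
        using x by (auto intro!: derivative_eq_intros simp: power2_eq_square)
      have d2: "((\<lambda>q. q + b / q) has_real_derivative 1 - b / x\<^sup>2) (at x)"
        using x by (auto intro!: derivative_eq_intros simp: power2_eq_square)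
      have "x + b / x > 0" using x b by (simp add: add_pos_pos)
      from DERIV_cdivide[OF DERIV_add[OF DERIV_chain2[OF dH d1] DERIV_chain2[OF G[OF this] d2]], of 2]
      have "(F has_real_derivative (1 / W * (1 + b / x\<^sup>2) + 1 / W * (1 - b / x\<^sup>2)) / 2) (at x)"
        unfolding F_def W .
      also have "(1 / W * (1 + b / x\<^sup>2) + 1 / W * (1 - b / x\<^sup>2)) / 2 = 1 / W"
        by (simp add: add_divide_distrib [symmetric])
      also have "1 / W = f x"
      proof -
        have "(1 + x\<^sup>2) * (b\<^sup>2 + c\<^sup>2 + x\<^sup>2) - c\<^sup>2 = x\<^sup>2 * W"
          unfolding W_def using x by (simp add: power2_eq_square field_simps)
        then show ?thesis using x Wpos by (simp add: f_def)
      qed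
      finally show "(F has_real_derivative f x) (at x)" .
    next
      have l1: "filterlim (\<lambda>q. q - b / q) at_bot (at_right 0)" using b by real_asymp
      have l2: "filterlim (\<lambda>q. q + b / q) at_top (at_right 0)" using b by real_asymp
      have l3: "filterlim (\<lambda>q. q - b / q) at_top at_top" by real_asymp
      have l4: "filterlim (\<lambda>q. q + b / q) at_top at_top" by real_asymp
      show "(F \<longlongrightarrow> (- ((pi/2) / S) + L) / 2) (at_right 0)"
        unfolding F_def by (intro tendsto_intros filterlim_compose[OF Hbot l1] filterlim_compose[OF GL l2]) auto
      show "(F \<longlongrightarrow> ((pi/2) / S + L) / 2) at_top"
        unfolding F_def by (intro tendsto_intros filterlim_compose[OF Htop l3] filterlim_compose[OF GL l4]) auto
    qed (use cont nonneg in auto)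
    also have "((pi/2) / S + L) / 2 - (- ((pi/2) / S) + L) / 2 = pi / (2 * S)"
      using S(1) by (simp add: field_simps)
    finally show ?thesis .
  qed
  then show ?thesis by (simp add: f_def S_def)
qed

section \<open>Tonelli and measurability\<close>

lemma nn_set_integral_swap:
  fixes f :: "real \<Rightarrow> real \<Rightarrow> ennreal"
  assumes [measurable]: "case_prod f \<in> borel_measurable (borel \<Otimes>\<^sub>M borel)"
    and [measurable]: "A \<in> sets borel" "B \<in> sets borel"
  shows "(\<integral>\<^sup>+x\<in>A. (\<integral>\<^sup>+y\<in>B. f x y \<partial>lborel) \<partial>lborel) = (\<integral>\<^sup>+y\<in>B. (\<integral>\<^sup>+x\<in>A. f x y \<partial>lborel) \<partial>lborel)"
proof -
  have "(\<integral>\<^sup>+x\<in>A. (\<integral>\<^sup>+y\<in>B. f x y \<partial>lborel) \<partial>lborel)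
      = (\<integral>\<^sup>+x. (\<integral>\<^sup>+y. f x y * indicator B y * indicator A x \<partial>lborel) \<partial>lborel)"
    by (intro nn_integral_cong nn_integral_multc [symmetric]) measurable
  also have "\<dots> = (\<integral>\<^sup>+y. (\<integral>\<^sup>+x. f x y * indicator B y * indicator A x \<partial>lborel) \<partial>lborel)"
    by (rule lborel_pair.Fubini' [symmetric]) measurable
  also have "\<dots> = (\<integral>\<^sup>+y. (\<integral>\<^sup>+x. f x y * indicator A x * indicator B y \<partial>lborel) \<partial>lborel)"
    by (simp only: mult.assoc mult.commute mult.left_commute)
  also have "\<dots> = (\<integral>\<^sup>+y\<in>B. (\<integral>\<^sup>+x\<in>A. f x y \<partial>lborel) \<partial>lborel)"
    by (intro nn_integral_cong nn_integral_multc) measurable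
  finally show ?thesis .
qed

lemma nn_set_integral_rotate:
  fixes G :: "real \<Rightarrow> real \<Rightarrow> real \<Rightarrow> ennreal"
  assumes [measurable]: "(\<lambda>(x, y, z). G x y z) \<in> borel_measurable (borel \<Otimes>\<^sub>M borel \<Otimes>\<^sub>M borel)"
    and [measurable]: "A \<in> sets borel" "B \<in> sets borel" "C \<in> sets borel"
  shows "(\<integral>\<^sup>+x\<in>A. (\<integral>\<^sup>+y\<in>B. (\<integral>\<^sup>+z\<in>C. G x y z \<partial>lborel) \<partial>lborel) \<partial>lborel)
       = (\<integral>\<^sup>+z\<in>C. (\<integral>\<^sup>+x\<in>A. (\<integral>\<^sup>+y\<in>B. G x y z \<partial>lborel) \<partial>lborel) \<partial>lborel)"
proof -
  define G' where "G' = (\<lambda>(x, y, z). G x y z)"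
  have [measurable]: "G' \<in> borel_measurable (borel \<Otimes>\<^sub>M borel \<Otimes>\<^sub>M borel)"
    unfolding G'_def by (rule assms)
  have G: "G x y z = G' (x, y, z)" for x y z by (simp add: G'_def)
  have "(\<integral>\<^sup>+y\<in>B. (\<integral>\<^sup>+z\<in>C. G x y z \<partial>lborel) \<partial>lborel) = (\<integral>\<^sup>+z\<in>C. (\<integral>\<^sup>+y\<in>B. G x y z \<partial>lborel) \<partial>lborel)" for x
    unfolding G by (rule nn_set_integral_swap) measurable
  moreover have "(\<integral>\<^sup>+x\<in>A. (\<integral>\<^sup>+z\<in>C. (\<integral>\<^sup>+y\<in>B. G x y z \<partial>lborel) \<partial>lborel) \<partial>lborel)
      = (\<integral>\<^sup>+z\<in>C. (\<integral>\<^sup>+x\<in>A. (\<integral>\<^sup>+y\<in>B. G x y z \<partial>lborel) \<partial>lborel) \<partial>lborel)"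
    unfolding G by (rule nn_set_integral_swap) measurable
  ultimately show ?thesis by simp
qed

lemma nn_set_integral_cmult:
  fixes f :: "real \<Rightarrow> real"
  assumes [measurable]: "f \<in> borel_measurable borel" "A \<in> sets borel" and "k \<ge> 0"
  shows "(\<integral>\<^sup>+x\<in>A. ennreal (k * f x) \<partial>lborel) = ennreal k * (\<integral>\<^sup>+x\<in>A. ennreal (f x) \<partial>lborel)"
  using \<open>k \<ge> 0\<close> by (simp add: ennreal_mult' mult.assoc nn_integral_cmult)

lemma borel_measurable_tan [measurable]: "(tan :: real \<Rightarrow> real) \<in> borel_measurable borel"
proof -
  have [measurable]: "(sin :: real \<Rightarrow> real) \<in> borel_measurable borel" "(cos :: real \<Rightarrow> real) \<in> borel_measurable borel"
    by (auto intro!: borel_measurable_continuous_onI continuous_intros)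
  have "(\<lambda>x::real. sin x / cos x) \<in> borel_measurable borel" by measurable
  then show ?thesis by (simp add: tan_def [abs_def])
qed

section \<open>The elliptic integral as an inner integral\<close>

lemma ellipticK_nonneg:
  assumes "k\<^sup>2 \<le> 1"
  shows "0 \<le> ellipticK k"
proof -
  have "0 \<le> 1 / sqrt (1 - k\<^sup>2 * (sin \<phi>)\<^sup>2)" for \<phi>
    using mult_le_one[OF assms, of "(sin \<phi>)\<^sup>2"] by (simp add: abs_square_le_1)
  then show ?thesis
    unfolding ellipticK_def by (cases "(\<lambda>\<phi>. 1 / sqrt (1 - k\<^sup>2 * (sin \<phi>)\<^sup>2)) integrable_on {0..pi/2}")
      (auto intro: integral_nonneg simp: not_integrable_integral)
qed

text \<open>
  Absorbing the factor \<^term>\<open>1 / sqrt M\<close> frees the integrand from the quotient in the modulus. The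
  hypothesis \<^term>\<open>0 < N\<close> says that the modulus is less than 1.
\<close>

lemma nn_integral_ellipticK:
  fixes M N :: real assumes "0 < N" "N \<le> M"
  shows "(\<integral>\<^sup>+\<phi>\<in>{0<..<pi/2}. ennreal (1 / sqrt (M - (M - N) * (sin \<phi>)\<^sup>2)) \<partial>lborel)
       = ennreal (ellipticK (sqrt ((M - N) / M)) / sqrt M)"
proof -
  define k where "k = sqrt ((M - N) / M)"
  have M: "M > 0" using assms by simp
  have k: "k\<^sup>2 = (M - N) / M" using assms by (simp add: k_def)
  have scale: "M * (1 - k\<^sup>2 * (sin \<phi>)\<^sup>2) = M - (M - N) * (sin \<phi>)\<^sup>2" for \<phi>
    using M by (simp add: k field_simps)
  have pos: "1 - k\<^sup>2 * (sin \<phi>)\<^sup>2 > 0" for \<phi>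
  proof -
    have "k\<^sup>2 < 1" "0 \<le> k\<^sup>2" using assms M by (simp_all add: k)
    moreover have "(sin \<phi>)\<^sup>2 \<le> 1" by (simp add: power_le_one_iff abs_square_le_1)
    ultimately have "k\<^sup>2 * (sin \<phi>)\<^sup>2 < 1"
      by (meson le_less_trans mult_left_le)
    then show ?thesis by simp
  qed
  have "continuous_on {0..pi/2} (\<lambda>\<phi>. 1 / sqrt (1 - k\<^sup>2 * (sin \<phi>)\<^sup>2))"
    using pos by (intro continuous_intros) (auto simp: less_imp_neq[symmetric])
  then have "((\<lambda>\<phi>. 1 / sqrt (1 - k\<^sup>2 * (sin \<phi>)\<^sup>2)) has_integral ellipticK k) {0..pi/2}"
    unfolding ellipticK_def by (intro integrable_integral integrable_continuous_interval)
  then have "((\<lambda>\<phi>. 1 / sqrt (1 - k\<^sup>2 * (sin \<phi>)\<^sup>2) / sqrt M) has_integral ellipticK k / sqrt M) {0<..<pi/2}"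
    by (intro has_integral_divide) (simp add: has_integral_Icc_iff_Ioo)
  moreover have "1 / sqrt (1 - k\<^sup>2 * (sin \<phi>)\<^sup>2) / sqrt M = 1 / sqrt (M - (M - N) * (sin \<phi>)\<^sup>2)" for \<phi>
    by (simp add: scale [symmetric] real_sqrt_mult mult.commute)
  ultimately have "((\<lambda>\<phi>. 1 / sqrt (M - (M - N) * (sin \<phi>)\<^sup>2)) has_integral ellipticK k / sqrt M) {0<..<pi/2}"
    by simp
  moreover have "0 \<le> 1 / sqrt (M - (M - N) * (sin \<phi>)\<^sup>2)" for \<phi>
    using pos[of \<phi>] M by (simp add: scale [symmetric])
  ultimately show ?thesis
    unfolding k_def by (intro nn_integral_has_integral_lebesgue') auto
qed

section \<open>The Poisson formula\<close>

text \<open>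
  This is the Poisson formula at the point of height 1 on the axis. As an iterated integral of a
  nonnegative measurable function it also covers \<^term>\<open>b = 0\<close>, where the source lies in the
  plane of integration and the inner integral is infinite at \<open>tan \<theta> = c\<close> if \<open>c > 0\<close>.
\<close>

lemma nn_integral_Poisson_formula:
  fixes b c :: real assumes "b \<ge> 0" "c \<ge> 0"
  shows "(\<integral>\<^sup>+\<theta>\<in>{0<..<pi/2}. (\<integral>\<^sup>+\<phi>\<in>{0<..<pi/2}.
            ennreal (sin \<theta> / sqrt (b\<^sup>2 + (c + tan \<theta>)\<^sup>2 - 4 * c * tan \<theta> * (sin \<phi>)\<^sup>2)) \<partial>lborel) \<partial>lborel)
       = ennreal (pi / (2 * sqrt ((b + 1)\<^sup>2 + c\<^sup>2)))"
proof -
  define I where "I = {0<..<pi/2}"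
  define A where "A = (\<lambda>\<theta>::real. 1 + (tan \<theta>)\<^sup>2)"
  define B where "B = (\<lambda>\<theta> \<phi>. b\<^sup>2 + (c + tan \<theta>)\<^sup>2 - 4 * c * tan \<theta> * (sin \<phi>)\<^sup>2)"
  define g where "g = (\<lambda>\<theta> \<phi> q. 4 / pi * (tan \<theta> * A \<theta>) * (q\<^sup>2 / (B \<theta> \<phi> + A \<theta> * q\<^sup>2)\<^sup>2))"
  have [measurable]: "(sin :: real \<Rightarrow> real) \<in> borel_measurable borel"
    by (auto intro!: borel_measurable_continuous_onI continuous_intros)
  have [measurable]: "I \<in> sets borel" by (simp add: I_def)
  have A: "A \<theta> > 0" for \<theta> by (simp add: A_def add_pos_nonneg)
  have step1: "ennreal (sin \<theta> / sqrt (B \<theta> \<phi>)) = (\<integral>\<^sup>+q\<in>{0<..}. ennreal (g \<theta> \<phi> q) \<partial>lborel)"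
    if "\<theta> \<in> I" "\<phi> \<in> I" for \<theta> \<phi>
  proof -
    define t where "t = tan \<theta>"
    have t: "t > 0" using that tan_gt_zero[of \<theta>] by (simp add: t_def I_def)
    have ct: "cos \<theta> > 0" "cos \<phi> > 0" using that by (auto simp: I_def intro: cos_gt_zero)
    \<comment> \<open>In this form \<^term>\<open>B \<theta> \<phi>\<close> is positive even for \<^term>\<open>b = 0\<close>, as \<^term>\<open>c + t\<close> and \<^term>\<open>cos \<phi>\<close> are.\<close>
    have "B \<theta> \<phi> = b\<^sup>2 + (c - t)\<^sup>2 * (sin \<phi>)\<^sup>2 + (c + t)\<^sup>2 * (cos \<phi>)\<^sup>2"
      unfolding cos_squared_eq by (simp add: B_def t_def power2_eq_square algebra_simps)
    also have "\<dots> > 0"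
      using t ct assms by (intro add_nonneg_pos mult_pos_pos add_nonneg_nonneg) auto
    finally have B: "B \<theta> \<phi> > 0" .
    have "A \<theta> = (1 / cos \<theta>)\<^sup>2"
      using tan_sec[of \<theta>] ct by (simp add: A_def power_divide divide_inverse power_inverse)
    then have sA: "sqrt (A \<theta>) = 1 / cos \<theta>" using ct by simp
    have "(\<integral>\<^sup>+q\<in>{0<..}. ennreal (g \<theta> \<phi> q) \<partial>lborel)
        = ennreal (4 / pi * (t * A \<theta>)) * (\<integral>\<^sup>+q\<in>{0<..}. ennreal (q\<^sup>2 / (B \<theta> \<phi> + A \<theta> * q\<^sup>2)\<^sup>2) \<partial>lborel)"
      unfolding g_def t_def [symmetric] using t A[of \<theta>]
      by (intro nn_set_integral_cmult) auto
    also have "\<dots> = ennreal (4 / pi * (t * A \<theta>) * (pi / (4 * (A \<theta> * sqrt (A \<theta>) * sqrt (B \<theta> \<phi>)))))"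
      unfolding nn_integral_Feynman_parameter[OF A B] using t A[of \<theta>]
      by (intro ennreal_mult' [symmetric]) simp
    also have "4 / pi * (t * A \<theta>) * (pi / (4 * (A \<theta> * sqrt (A \<theta>) * sqrt (B \<theta> \<phi>)))) = t / (sqrt (A \<theta>) * sqrt (B \<theta> \<phi>))"
      using A[of \<theta>] by simp
    also have "\<dots> = sin \<theta> / sqrt (B \<theta> \<phi>)"
      unfolding sA t_def using ct by (simp add: tan_def)
    finally show ?thesis by simp
  qed
  have step2: "(\<integral>\<^sup>+\<theta>\<in>I. (\<integral>\<^sup>+\<phi>\<in>I. ennreal (g \<theta> \<phi> q) \<partial>lborel) \<partial>lborel)
       = ennreal (q\<^sup>2 / ((1 + q\<^sup>2) * (b\<^sup>2 + c\<^sup>2 + q\<^sup>2) - c\<^sup>2))" if q: "q > 0" for q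
  proof -
    define P where "P = 1 + q\<^sup>2"
    define Q where "Q = b\<^sup>2 + c\<^sup>2 + q\<^sup>2"
    define R where "R = (\<lambda>t. (P * t\<^sup>2 + Q)\<^sup>2 - (2 * c * t)\<^sup>2)"
    have P: "P > 0" and Q: "Q > 0" using q by (auto simp: P_def Q_def intro!: add_pos_nonneg add_nonneg_pos)
    have "P * Q - c\<^sup>2 = (1 + q\<^sup>2) * (b\<^sup>2 + q\<^sup>2) + c\<^sup>2 * q\<^sup>2"
      by (simp add: P_def Q_def algebra_simps)
    also have "\<dots> > 0" using q by (intro add_pos_nonneg mult_pos_pos add_nonneg_pos) auto
    finally have PQ: "c\<^sup>2 < P * Q" by simp
    define r where "r = (\<lambda>\<theta>. 2 * tan \<theta> * (P * (tan \<theta>)\<^sup>2 + Q) / (R (tan \<theta>) * sqrt (R (tan \<theta>))) * (1 + (tan \<theta>)\<^sup>2))"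
    have phi: "(\<integral>\<^sup>+\<phi>\<in>I. ennreal (g \<theta> \<phi> q) \<partial>lborel) = ennreal (q\<^sup>2 * r \<theta>)" if "\<theta> \<in> I" for \<theta>
    proof -
      define t where "t = tan \<theta>"
      have t: "t > 0" using that tan_gt_zero[of \<theta>] by (simp add: t_def I_def)
      define M where "M = b\<^sup>2 + (c + t)\<^sup>2 + A \<theta> * q\<^sup>2"
      define N where "N = b\<^sup>2 + (c - t)\<^sup>2 + A \<theta> * q\<^sup>2"
      have MN: "M > 0" "N > 0" using A[of \<theta>] q by (auto simp: M_def N_def intro!: add_nonneg_pos)
      have sum: "M + N = 2 * (P * t\<^sup>2 + Q)" and prod: "M * N = R t"
        unfolding M_def N_def P_def Q_def R_def A_def t_def by (simp_all add: power2_eq_square algebra_simps)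
      have BM: "B \<theta> \<phi> + A \<theta> * q\<^sup>2 = M - (M - N) * (sin \<phi>)\<^sup>2" for \<phi>
      proof -
        have "M - N = 4 * c * t" by (simp add: M_def N_def power2_eq_square algebra_simps)
        then show ?thesis by (simp add: B_def M_def t_def)
      qed
      define k where "k = 4 / pi * (t * A \<theta>) * q\<^sup>2"
      have k: "k \<ge> 0" using t A[of \<theta>] by (simp add: k_def)
      have "(\<integral>\<^sup>+\<phi>\<in>I. ennreal (g \<theta> \<phi> q) \<partial>lborel)
          = (\<integral>\<^sup>+\<phi>\<in>I. ennreal (k * (1 / (M - (M - N) * (sin \<phi>)\<^sup>2)\<^sup>2)) \<partial>lborel)"
        by (simp add: g_def k_def BM t_def)
      also have "\<dots> = ennreal k * (\<integral>\<^sup>+\<phi>\<in>I. ennreal (1 / (M - (M - N) * (sin \<phi>)\<^sup>2)\<^sup>2) \<partial>lborel)"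
        using k by (intro nn_set_integral_cmult) auto
      also have "\<dots> = ennreal (k * (pi * (M + N) / (4 * (M * N * sqrt (M * N)))))"
        unfolding I_def nn_integral_angular[OF MN] by (rule ennreal_mult' [symmetric, OF k])
      also have "k * (pi * (M + N) / (4 * (M * N * sqrt (M * N))))
          = q\<^sup>2 * (2 * t * (P * t\<^sup>2 + Q) / (R t * sqrt (R t)) * A \<theta>)"
        unfolding sum prod k_def by simp
      finally show ?thesis unfolding r_def t_def A_def .
    qed
    have [measurable]: "r \<in> borel_measurable borel" unfolding r_def R_def by measurable
    have "(\<integral>\<^sup>+\<theta>\<in>I. (\<integral>\<^sup>+\<phi>\<in>I. ennreal (g \<theta> \<phi> q) \<partial>lborel) \<partial>lborel) = (\<integral>\<^sup>+\<theta>\<in>I. ennreal (q\<^sup>2 * r \<theta>) \<partial>lborel)"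
      by (rule set_nn_integral_cong) (simp_all add: phi)
    also have "\<dots> = ennreal (q\<^sup>2) * (\<integral>\<^sup>+\<theta>\<in>I. ennreal (r \<theta>) \<partial>lborel)"
      by (rule nn_set_integral_cmult) simp_all
    also have "\<dots> = ennreal (q\<^sup>2 * (1 / (P * Q - c\<^sup>2)))"
      unfolding I_def r_def R_def nn_integral_radial[OF P Q PQ] by (rule ennreal_mult' [symmetric]) simp
    finally show ?thesis by (simp add: P_def Q_def)
  qed
  have "(\<integral>\<^sup>+\<theta>\<in>I. (\<integral>\<^sup>+\<phi>\<in>I. ennreal (sin \<theta> / sqrt (B \<theta> \<phi>)) \<partial>lborel) \<partial>lborel)
      = (\<integral>\<^sup>+\<theta>\<in>I. (\<integral>\<^sup>+\<phi>\<in>I. (\<integral>\<^sup>+q\<in>{0<..}. ennreal (g \<theta> \<phi> q) \<partial>lborel) \<partial>lborel) \<partial>lborel)"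
    using step1 by (intro set_nn_integral_cong refl) auto
  also have "\<dots> = (\<integral>\<^sup>+q\<in>{0<..}. (\<integral>\<^sup>+\<theta>\<in>I. (\<integral>\<^sup>+\<phi>\<in>I. ennreal (g \<theta> \<phi> q) \<partial>lborel) \<partial>lborel) \<partial>lborel)"
    unfolding g_def A_def B_def by (rule nn_set_integral_rotate) measurable
  also have "\<dots> = (\<integral>\<^sup>+q\<in>{0<..}. ennreal (q\<^sup>2 / ((1 + q\<^sup>2) * (b\<^sup>2 + c\<^sup>2 + q\<^sup>2) - c\<^sup>2)) \<partial>lborel)"
    using step2 by (intro set_nn_integral_cong refl) auto
  also have "\<dots> = ennreal (pi / (2 * sqrt ((b + 1)\<^sup>2 + c\<^sup>2)))"
    by (rule nn_integral_height[OF assms(1)])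
  finally show ?thesis unfolding I_def B_def .
qed

theorem mainTheorem4:
  fixes b c :: real
  assumes "b \<ge> 0" and "c \<ge> 0"
  shows "((\<lambda>\<theta>. ellipticK (sqrt (4 * c * tan \<theta> / (b\<^sup>2 + (c + tan \<theta>)\<^sup>2)))
              * (sin \<theta> / sqrt (b\<^sup>2 + (c + tan \<theta>)\<^sup>2)))
           has_integral pi / (2 * sqrt ((b + 1)\<^sup>2 + c\<^sup>2))) {0..pi/2}"
proof -
  define h where "h = (\<lambda>\<theta>. ellipticK (sqrt (4 * c * tan \<theta> / (b\<^sup>2 + (c + tan \<theta>)\<^sup>2)))
              * (sin \<theta> / sqrt (b\<^sup>2 + (c + tan \<theta>)\<^sup>2)))"
  define V where "V = pi / (2 * sqrt ((b + 1)\<^sup>2 + c\<^sup>2))"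
  define J where "J = (\<lambda>\<theta>. (\<integral>\<^sup>+\<phi>\<in>{0<..<pi/2}.
     ennreal (sin \<theta> / sqrt (b\<^sup>2 + (c + tan \<theta>)\<^sup>2 - 4 * c * tan \<theta> * (sin \<phi>)\<^sup>2)) \<partial>lborel)
     * indicator {0<..<pi/2} \<theta>)"
  have V: "V \<ge> 0" by (simp add: V_def)
  have [measurable]: "(sin :: real \<Rightarrow> real) \<in> borel_measurable borel"
    by (auto intro!: borel_measurable_continuous_onI continuous_intros)
  have [measurable]: "J \<in> borel_measurable borel" unfolding J_def by measurable
  have J: "(\<integral>\<^sup>+\<theta>. J \<theta> \<partial>lborel) = ennreal V"
    unfolding J_def V_def by (rule nn_integral_Poisson_formula[OF assms])
  have "AE \<theta> in lborel. J \<theta> \<noteq> \<infinity>"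
    using J by (intro nn_integral_PInf_AE) auto
  then have "(\<integral>\<^sup>+\<theta>. ennreal (enn2real (J \<theta>)) \<partial>lborel) = (\<integral>\<^sup>+\<theta>. J \<theta> \<partial>lborel)"
    by (intro nn_integral_cong_AE) (auto simp: top.not_eq_extremum)
  then have "((\<lambda>\<theta>. enn2real (J \<theta>)) has_integral V) UNIV"
    using J V by (intro nn_integral_has_integral) auto
  then have "((\<lambda>\<theta>. if \<theta> \<in> {0..pi/2} then h \<theta> else 0) has_integral V) UNIV"
  proof (rule has_integral_spike[where S = "{0, pi/2, arctan c}", rotated -1])
    \<comment> \<open>The point \<^term>\<open>arctan c\<close> matters for \<^term>\<open>b = 0\<close>: there the modulus is 1 if \<^term>\<open>c > 0\<close>.\<close>
    show "negligible {0, pi/2, arctan c}" by (rule negligible_finite) simp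
    fix \<theta> assume \<theta>: "\<theta> \<in> UNIV - {0, pi/2, arctan c}"
    show "(if \<theta> \<in> {0..pi/2} then h \<theta> else 0) = enn2real (J \<theta>)"
    proof (cases "\<theta> \<in> {0<..<pi/2}")
      case False
      with \<theta> show ?thesis by (auto simp: J_def)
    next
      case True
      define t where "t = tan \<theta>"
      have t: "t > 0" using True tan_gt_zero[of \<theta>] by (simp add: t_def)
      have "arctan t = \<theta>" unfolding t_def using True by (intro arctan_tan) auto
      with \<theta> have tc: "t \<noteq> c" by auto
      have s: "sin \<theta> \<ge> 0" using True by (intro sin_ge_zero) auto
      define M where "M = b\<^sup>2 + (c + t)\<^sup>2"
      define N where "N = b\<^sup>2 + (c - t)\<^sup>2"
      have MN: "M - N = 4 * c * t" by (simp add: M_def N_def power2_eq_square algebra_simps)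
      have N: "0 < N" using tc by (simp add: N_def add_nonneg_pos)
      have NM: "N \<le> M" using MN t assms by (metis diff_ge_0_iff_ge mult_nonneg_nonneg less_imp_le zero_le_numeral)
      define K where "K = ellipticK (sqrt ((M - N) / M)) / sqrt M"
      have Kint: "(\<integral>\<^sup>+\<phi>\<in>{0<..<pi/2}. ennreal (1 / sqrt (M - (M - N) * (sin \<phi>)\<^sup>2)) \<partial>lborel) = ennreal K"
        unfolding K_def by (rule nn_integral_ellipticK[OF N NM])
      have "J \<theta> = (\<integral>\<^sup>+\<phi>\<in>{0<..<pi/2}. ennreal (sin \<theta> * (1 / sqrt (M - (M - N) * (sin \<phi>)\<^sup>2))) \<partial>lborel)"
        unfolding J_def MN using True by (simp add: M_def t_def)
      also have "\<dots> = ennreal (sin \<theta>) * ennreal K"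
        unfolding Kint [symmetric] using s by (intro nn_set_integral_cmult) auto
      finally have "enn2real (J \<theta>) = sin \<theta> * enn2real (ennreal K)"
        using s by (simp add: enn2real_mult)
      moreover have "K \<ge> 0"
      proof -
        have "(sqrt ((M - N) / M))\<^sup>2 \<le> 1" using N NM by simp
        then show ?thesis using N NM by (simp add: K_def ellipticK_nonneg)
      qed
      moreover have "h \<theta> = sin \<theta> * K"
        unfolding h_def K_def MN by (simp add: M_def t_def)
      ultimately show ?thesis using True by simp
    qed
  qed
  then show ?thesis
    unfolding has_integral_restrict_UNIV h_def V_def .
qed

end
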